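(* Let $\mathbb{B}$ be a real separable Banach space, $F:\mathbb{B}\to\mathbb{B}$ a contraction with constant $c\in[0,1)$ and unique fixed point $x^*$, let $(\xi_n)_{n\ge 1}$ be independent zero-mean $\mathbb{B}$-valued random variables with $\sup_n\mathbb{E}\|\xi_n\|<\infty$, and suppose that for some constants $\sigma$ and $L>0$ one has $\mathbb{E}\|\xi_i\|^m\le \frac{m!}{2}\sigma^2L^{m-2}$ for all $i\ge1$ and all integers $m\ge2$. Let $a>0$ satisfy $a(1-c)<1$, let $0<\rho<2a(1-c)$, and let $(x_n)_{n\ge1}$ be the stochastic Mann sequence $x_{n+1}=(1-\frac{a}{n})x_n+\frac{a}{n}\left[F(x_n)+\frac1n\xi_n\right]$, started at $x_1\in\mathbb{B}$ with $\|x_1-x^*\|\le N$. Then $$x_{n+1}-x^*=O\left(\sqrt{\frac{\ln n}{n^{a(1-c)-\rho}}}\right)\quad\text{almost completely}.$$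
   Context: $(\Omega,\mathcal{F},\mathbb{P})$ is a probability space carrying all random variables; $\mathbb{B}$ is equipped with its Borel $\sigma$-algebra. $F$ is a contraction with constant $c$ means $\|F(x)-F(y)\|\le c\|x-y\|$ for all $x,y\in\mathbb{B}$, with $c\in[0,1)$; by Banach's theorem $F$ has a unique fixed point $x^*$. For a sequence $(r_n)$ of positive reals, $x_{n+1}-x^*=O(r_n)$ almost completely means that there exists a constant $\epsilon_0>0$ such that $\sum_{n=1}^{+\infty}\mathbb{P}\{\|x_{n+1}-x^*\|>\epsilon_0r_n\}<+\infty$ (the finitely many indices with $r_n=0$ are irrelevant). *)

theory Defs
  imports "HOL-Probability.Probability"
begin

text \<open>
  \<open>Y n = O(r n)\<close> almost completely, the index \<open>n\<close> ranging over the positive integers.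
  The conjunct on measurability excludes the junk value \<open>measure M A = 0\<close> for a
  non-measurable \<open>A\<close>.
\<close>

definition almost_completely_bigo ::
  "'a measure \<Rightarrow> (nat \<Rightarrow> 'a \<Rightarrow> 'b::real_normed_vector) \<Rightarrow> (nat \<Rightarrow> real) \<Rightarrow> bool" where
  "almost_completely_bigo M Y r \<longleftrightarrow>
     (\<forall>n\<ge>1. Y n \<in> borel_measurable M) \<and>
     (\<exists>\<epsilon>\<^sub>0>0. summable (\<lambda>n. measure M {\<omega> \<in> space M. norm (Y (Suc n) \<omega>) > \<epsilon>\<^sub>0 * r (Suc n)}))"

end

theory Submission imports Defs
begin

text \<open>
  Put \<open>\<alpha> = a (1 - c)\<close> and \<open>e\<^sub>n = n\<^sup>\<alpha> \<parallel>x\<^sub>n - x\<^sup>*\<parallel>\<close>. Once \<open>n \<ge> a\<close>, one step contracts the error by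
  \<open>1 - \<alpha>/n \<le> (n/(n+1))\<^sup>\<alpha>\<close>, so that \<open>e\<^sub>n\<^sub>+\<^sub>1 \<le> e\<^sub>n + 2 a n\<^sup>\<alpha>\<^sup>-\<^sup>2 \<parallel>\<xi>\<^sub>n\<parallel>\<close>. As \<open>\<alpha> < 1\<close>, the weights
  \<open>n\<^sup>\<alpha>\<^sup>-\<^sup>2\<close> are summable, and Jensen's inequality bounds every moment of \<open>e\<^sub>n\<close> uniformly in \<open>n\<close>.
  The asserted rate allows \<open>e\<^sub>n\<close> to grow like \<open>n\<close> to the power \<open>\<delta> = (\<alpha> + \<rho>) / 2 > 0\<close>, so
  Markov's inequality for a moment of order \<open>m\<close> with \<open>m \<delta> \<ge> 2\<close> gives summable probabilities.
\<close>

text \<open>Jensen's inequality for a convex power, with the normalised weights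
  \<open>w i / W\<close>; clearing denominators turns \<open>W ^ Suc m / W\<close> into
  \<open>W ^ m\<close>.\<close>

lemma weighted_sum_power_le:
  fixes w z :: "'i \<Rightarrow> real"
  assumes "finite I" and "\<And>i. i \<in> I \<Longrightarrow> 0 \<le> w i" and "\<And>i. i \<in> I \<Longrightarrow> 0 \<le> z i"
  shows "(\<Sum>i\<in>I. w i * z i) ^ Suc m \<le> (\<Sum>i\<in>I. w i) ^ m * (\<Sum>i\<in>I. w i * z i ^ Suc m)"
proof (cases "(\<Sum>i\<in>I. w i) = 0")
  case True
  then have "\<And>i. i \<in> I \<Longrightarrow> w i = 0"
    using assms by (simp add: sum_nonneg_eq_0_iff)
  then show ?thesis by simp
next
  case False
  define W where "W = (\<Sum>i\<in>I. w i)"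
  have W: "W > 0"
    using False assms(2) by (simp add: W_def order_less_le sum_nonneg)
  have I: "I \<noteq> {}" using False by auto
  \<comment> \<open>Even powers are convex on the whole line, odd ones only on the half-line, hence
    the split by parity.\<close>
  have convex: "convex_on {0..} (\<lambda>x::real. x ^ Suc m)"
    using convex_power_even[of "Suc m"] convex_power_odd[of "Suc m"]
    by (cases "even (Suc m)") (auto intro: convex_on_subset)
  have "(\<Sum>i\<in>I. (w i / W) *\<^sub>R z i) ^ Suc m \<le> (\<Sum>i\<in>I. (w i / W) * z i ^ Suc m)"
  proof (rule convex_on_sum[where C = "{0..}" and f = "\<lambda>x. x ^ Suc m"])
    show "(\<Sum>i\<in>I. w i / W) = 1"
      using W by (simp add: W_def flip: sum_divide_distrib)
  qed (use assms I W convex in auto)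
  then have "(\<Sum>i\<in>I. w i * z i) ^ Suc m / W ^ Suc m \<le> (\<Sum>i\<in>I. w i * z i ^ Suc m) / W"
    by (simp add: power_divide flip: sum_divide_distrib)
  then show ?thesis
    using W by (simp add: field_simps flip: W_def)
qed

text \<open>Among the factors met in unrolling the recurrence, only the first
  \<open>n\<^sub>0\<close> can exceed 1. Each of these costs at most \<open>K\<close>, and
  \<open>1 \<le> K\<close> lets the same power cover the perturbations \<open>b i\<close>.\<close>

lemma eventually_nonexpanding_recurrence:
  fixes e b p :: "nat \<Rightarrow> real"
  assumes "\<And>n. n \<ge> 1 \<Longrightarrow> e (Suc n) \<le> p n * e n + b n"
    and "\<And>n. 0 \<le> e n" and "\<And>n. 0 \<le> b n"
    and "1 \<le> K" and "\<And>n. n \<ge> 1 \<Longrightarrow> p n \<le> K" and "\<And>n. n > n\<^sub>0 \<Longrightarrow> p n \<le> 1"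
  shows "e (Suc n) \<le> K ^ n\<^sub>0 * (e 1 + (\<Sum>i=1..n. b i))"
proof -
  \<comment> \<open>The exponent \<open>min n n\<^sub>0\<close> counts the possibly expanding steps
    made so far; with \<open>K ^ n\<^sub>0\<close> from the start the induction would not
    close.\<close>
  have "e (Suc n) \<le> K ^ min n n\<^sub>0 * (e 1 + (\<Sum>i=1..n. b i))"
  proof (induction n)
    case (Suc n)
    define S where "S = e 1 + (\<Sum>i=1..n. b i)"
    have S: "0 \<le> S" using assms(2,3) by (simp add: S_def sum_nonneg)
    have p: "p (Suc n) * K ^ min n n\<^sub>0 \<le> K ^ min (Suc n) n\<^sub>0"
    proof (cases "Suc n \<le> n\<^sub>0")
      case True
      then show ?thesis using assms(4) assms(5)[of "Suc n"] by (simp add: min_def mult_right_mono)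
    next
      case False
      then have "min (Suc n) n\<^sub>0 = n\<^sub>0" "min n n\<^sub>0 = n\<^sub>0" by auto
      then show ?thesis using False assms(4) assms(6)[of "Suc n"] by (simp add: mult_left_le_one_le)
    qed
    \<comment> \<open>The factor may be negative. The induction hypothesis is multiplied by it only
      when it is nonnegative; otherwise the product is at most 0.\<close>
    have "p (Suc n) * e (Suc n) \<le> K ^ min (Suc n) n\<^sub>0 * S"
    proof (cases "p (Suc n) \<ge> 0")
      case True
      then have "p (Suc n) * e (Suc n) \<le> p (Suc n) * (K ^ min n n\<^sub>0 * S)"
        using Suc.IH unfolding S_def by (intro mult_left_mono) auto
      also have "\<dots> \<le> K ^ min (Suc n) n\<^sub>0 * S"
        using mult_right_mono[OF p S] by (simp add: mult.assoc)
      finally show ?thesis .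
    next
      case False
      then have "p (Suc n) * e (Suc n) \<le> 0"
        using assms(2)[of "Suc n"] by (simp add: mult_nonpos_nonneg)
      also have "0 \<le> K ^ min (Suc n) n\<^sub>0 * S" using S assms(4) by simp
      finally show ?thesis .
    qed
    moreover have "b (Suc n) \<le> K ^ min (Suc n) n\<^sub>0 * b (Suc n)"
      using mult_right_mono[OF one_le_power[OF assms(4)] assms(3)] by simp
    ultimately show ?case
      using assms(1)[of "Suc n"] by (simp add: S_def algebra_simps)
  qed simp
  also have "\<dots> \<le> K ^ n\<^sub>0 * (e 1 + (\<Sum>i=1..n. b i))"
    using assms(2-4) by (intro mult_right_mono power_increasing add_nonneg_nonneg sum_nonneg) auto
  finally show ?thesis .
qed

text \<open>Since \<open>p = F p\<close>, the error splits into a relaxed old error, a difference of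
  values of \<open>F\<close> and the noise. The absolute value stays because the step size
  \<open>t = a / n\<close> exceeds 1 as long as \<open>n < a\<close>.\<close>

lemma relaxed_step_error:
  fixes F :: "'b::real_normed_vector \<Rightarrow> 'b"
  assumes "c-lipschitz_on UNIV F" and "F p = p" and "0 \<le> t"
  shows "norm ((1 - t) *\<^sub>R x + t *\<^sub>R (F x + y) - p) \<le> (\<bar>1 - t\<bar> + t * c) * norm (x - p) + t * norm y"
proof -
  have "(1 - t) *\<^sub>R x + t *\<^sub>R (F x + y) - p = (1 - t) *\<^sub>R (x - p) + t *\<^sub>R (F x - F p) + t *\<^sub>R y"
    using assms(2) by (simp add: algebra_simps)
  also have "norm \<dots> \<le> \<bar>1 - t\<bar> * norm (x - p) + t * norm (F x - F p) + t * norm y"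
    using assms(3) by (intro order_trans[OF norm_triangle_ineq] add_mono) auto
  also have "\<dots> \<le> \<bar>1 - t\<bar> * norm (x - p) + t * (c * norm (x - p)) + t * norm y"
    using lipschitz_onD[OF assms(1), of x p] assms(3)
    by (intro add_mono mult_left_mono) (auto simp: dist_norm)
  finally show ?thesis by (simp add: algebra_simps)
qed

text \<open>Combines \<open>1 - s \<le> exp (- s)\<close> at \<open>s = \<alpha> / n\<close> with
  \<open>ln (1 + 1 / n) \<le> 1 / n\<close>: the growth of the weight \<open>n powr \<alpha>\<close>
  is absorbed by the contraction of one step.\<close>

lemma one_minus_divide_le_powr:
  fixes \<alpha> :: real
  assumes "0 \<le> \<alpha>" and "n \<ge> 1"
  shows "(1 - \<alpha> / real n) * real (Suc n) powr \<alpha> \<le> real n powr \<alpha>"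
proof -
  have "ln (real (Suc n)) - ln (real n) = ln (1 + 1 / real n)"
    using assms(2) by (simp add: add_divide_distrib add.commute flip: ln_divide_pos)
  also have "\<dots> \<le> 1 / real n"
    by (rule ln_add_one_self_le_self) simp
  finally have *: "\<alpha> * ln (real (Suc n)) - \<alpha> / real n \<le> \<alpha> * ln (real n)"
    using mult_left_mono[OF _ assms(1), of "ln (real (Suc n)) - ln (real n)" "1 / real n"]
    by (simp add: algebra_simps)
  have "(1 - \<alpha> / real n) * real (Suc n) powr \<alpha> \<le> exp (- (\<alpha> / real n)) * real (Suc n) powr \<alpha>"
    using exp_ge_add_one_self[of "- (\<alpha> / real n)"] by (intro mult_right_mono) auto
  also have "\<dots> = exp (\<alpha> * ln (real (Suc n)) - \<alpha> / real n)"
    by (simp add: powr_def exp_diff exp_minus field_simps)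
  also have "\<dots> \<le> real n powr \<alpha>"
    using * assms(2) by (simp add: powr_def)
  finally show ?thesis .
qed

lemma Suc_powr_le_double:
  fixes \<alpha> :: real
  assumes "0 \<le> \<alpha>" and "\<alpha> \<le> 1" and "n \<ge> 1"
  shows "real (Suc n) powr \<alpha> \<le> 2 * real n powr \<alpha>"
proof -
  have "real (Suc n) powr \<alpha> \<le> (2 * real n) powr \<alpha>"
    using assms by (intro powr_mono2) auto
  also have "\<dots> = 2 powr \<alpha> * real n powr \<alpha>" by (simp add: powr_mult)
  also have "2 powr \<alpha> \<le> 2 powr (1::real)" using assms by (intro powr_mono) auto
  finally show ?thesis by (simp add: mult_right_mono)
qed

text \<open>A pathwise estimate. The error weighted by \<open>n powr \<alpha>\<close> obeys a
  recurrence whose factors are at most \<open>2 * (1 + 2 * a)\<close> throughout, and at most 1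
  beyond \<open>nat \<lceil>a\<rceil>\<close>.\<close>

lemma mann_error_bound:
  fixes F :: "'b::real_normed_vector \<Rightarrow> 'b" and u v :: "nat \<Rightarrow> 'b" and a c :: real
  defines "\<alpha> \<equiv> a * (1 - c)"
  assumes "c-lipschitz_on UNIV F" and "F p = p" and "c < 1" and "a > 0" and "\<alpha> \<le> 1"
    and step: "\<And>n. n \<ge> 1 \<Longrightarrow> u (Suc n) = (1 - a / real n) *\<^sub>R u n
             + (a / real n) *\<^sub>R (F (u n) + (1 / real n) *\<^sub>R v n)"
  shows "real (Suc n) powr \<alpha> * norm (u (Suc n) - p)
    \<le> (2 * (1 + 2 * a)) ^ nat \<lceil>a\<rceil> *
       (norm (u 1 - p) + (\<Sum>i=1..n. 2 * a * real i powr (\<alpha> - 2) * norm (v i)))"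
proof -
  have c0: "0 \<le> c" using lipschitz_on_nonneg[OF assms(2)] .
  have \<alpha>0: "0 \<le> \<alpha>" using assms by (simp add: \<alpha>_def)
  define q where "q n = \<bar>1 - a / real n\<bar> + a / real n * c" for n
  define p' where "p' n = q n * real (Suc n) powr \<alpha> / real n powr \<alpha>" for n
  have q0: "0 \<le> q n" for n using c0 assms by (simp add: q_def)
  have "real (Suc n) powr \<alpha> * norm (u (Suc n) - p)
    \<le> (2 * (1 + 2 * a)) ^ nat \<lceil>a\<rceil> *
       (real 1 powr \<alpha> * norm (u 1 - p) + (\<Sum>i=1..n. 2 * a * real i powr (\<alpha> - 2) * norm (v i)))"
  proof (rule eventually_nonexpanding_recurrence[where p = p'])
    fix n :: nat assume n: "n \<ge> 1"
    have "norm (u (Suc n) - p) \<le> q n * norm (u n - p) + a / real n * norm ((1 / real n) *\<^sub>R v n)"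
      unfolding step[OF n] q_def using assms by (intro relaxed_step_error) auto
    then have "norm (u (Suc n) - p) \<le> q n * norm (u n - p) + a / (real n)\<^sup>2 * norm (v n)"
      by (simp add: power2_eq_square)
    then have "real (Suc n) powr \<alpha> * norm (u (Suc n) - p)
        \<le> real (Suc n) powr \<alpha> * (q n * norm (u n - p)) + real (Suc n) powr \<alpha> * (a / (real n)\<^sup>2 * norm (v n))"
      by (metis distrib_left mult_left_mono powr_ge_zero)
    also have "\<dots> \<le> real (Suc n) powr \<alpha> * (q n * norm (u n - p)) + 2 * real n powr \<alpha> * (a / (real n)\<^sup>2 * norm (v n))"
      using assms n \<alpha>0 by (intro add_left_mono mult_right_mono Suc_powr_le_double) auto
    \<comment> \<open>The noise carries \<open>1 / n\<close> inside a step of size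
      \<open>a / n\<close>; this square produces the exponent \<open>\<alpha> - 2\<close>.\<close>
    also have "2 * real n powr \<alpha> * (a / (real n)\<^sup>2 * norm (v n)) = 2 * a * real n powr (\<alpha> - 2) * norm (v n)"
      using n by (simp add: powr_diff)
    also have "real (Suc n) powr \<alpha> * (q n * norm (u n - p)) = p' n * (real n powr \<alpha> * norm (u n - p))"
      using n by (simp add: p'_def)
    finally show "real (Suc n) powr \<alpha> * norm (u (Suc n) - p) \<le>
       p' n * (real n powr \<alpha> * norm (u n - p)) + 2 * a * real n powr (\<alpha> - 2) * norm (v n)" .
    \<comment> \<open>A crude bound for the early steps: \<open>\<bar>1 - a / n\<bar>\<close> is at
      most \<open>1 + a\<close> and the Lipschitz part at most \<open>a\<close>; passing from
      \<open>n + 1\<close> to \<open>n\<close> in the weight costs a factor 2.\<close>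
    have "a / real n \<le> a" "a / real n * c \<le> a / real n"
      using n assms c0 by (auto simp: divide_le_eq mult_left_le)
    then have "q n \<le> 1 + 2 * a" using assms by (auto simp: q_def)
    then have "q n * real (Suc n) powr \<alpha> \<le> (1 + 2 * a) * (2 * real n powr \<alpha>)"
      using q0 assms n \<alpha>0 by (intro mult_mono Suc_powr_le_double) auto
    then show "p' n \<le> 2 * (1 + 2 * a)"
      using n by (simp add: p'_def field_simps)
  next
    fix n :: nat assume n: "n > nat \<lceil>a\<rceil>"
    \<comment> \<open>From here on the step size is at most 1, so the absolute value drops out and
      \<open>1 - a / n + a * c / n\<close> equals \<open>1 - \<alpha> / n\<close>.\<close>
    then have "a \<le> real n" by linarith
    then have "a / real n \<le> 1" using n by simp
    then have "\<bar>1 - a / real n\<bar> = 1 - a / real n" by simp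
    then have "q n = 1 - \<alpha> / real n" by (simp add: q_def \<alpha>_def right_diff_distrib diff_divide_distrib)
    then have "q n * real (Suc n) powr \<alpha> \<le> real n powr \<alpha>"
      using one_minus_divide_le_powr[OF \<alpha>0, of n] n by simp
    then show "p' n \<le> 1" using n by (simp add: p'_def)
  qed (use assms in auto)
  then show ?thesis by simp
qed

text \<open>Jensen's inequality dominates the power of the sum by \<open>V\<close>, whose
  expectation is linear in the moments of the \<open>Z i\<close>, and Markov's inequality is applied
  to \<open>V\<close>. Bounding partial sums of \<open>w\<close> by \<open>suminf w\<close> makes
  the estimate uniform in \<open>n\<close>.\<close>

lemma (in prob_space) weighted_sum_tail:
  fixes Z :: "nat \<Rightarrow> 'a \<Rightarrow> real" and w :: "nat \<Rightarrow> real"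
  assumes w: "\<And>i. 0 \<le> w i" "summable w"
    and Z: "\<And>i \<omega>. 0 \<le> Z i \<omega>"
    and int: "\<And>i. integrable M (\<lambda>\<omega>. Z i \<omega> ^ Suc m)"
    and mom: "\<And>i. expectation (\<lambda>\<omega>. Z i \<omega> ^ Suc m) \<le> C"
    and t: "0 < t" and sub: "A \<subseteq> {\<omega> \<in> space M. t \<le> (\<Sum>i\<le>n. w i * Z i \<omega>)}"
  shows "prob A \<le> suminf w ^ Suc m * C / t ^ Suc m"
proof -
  define W where "W = (\<Sum>i\<le>n. w i)"
  define V where "V \<omega> = W ^ m * (\<Sum>i\<le>n. w i * Z i \<omega> ^ Suc m)" for \<omega>
  have W: "0 \<le> W" "W \<le> suminf w"
    unfolding W_def using w by (auto intro: sum_nonneg sum_le_suminf)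
  have "0 \<le> expectation (\<lambda>\<omega>. Z 0 \<omega> ^ Suc m)" using Z by (intro Bochner_Integration.integral_nonneg) simp
  then have C: "0 \<le> C" using mom[of 0] by linarith
  have intV: "integrable M V"
    unfolding V_def by (intro integrable_mult_right Bochner_Integration.integrable_sum int)
  then have [measurable]: "V \<in> borel_measurable M" by auto
  have "A \<subseteq> {\<omega> \<in> space M. t ^ Suc m \<le> V \<omega>}"
  proof
    fix \<omega> assume "\<omega> \<in> A"
    then have \<omega>: "\<omega> \<in> space M" "t \<le> (\<Sum>i\<le>n. w i * Z i \<omega>)" using sub by auto
    have "t ^ Suc m \<le> (\<Sum>i\<le>n. w i * Z i \<omega>) ^ Suc m" using \<omega> t by (intro power_mono) auto
    also have "\<dots> \<le> V \<omega>"
      unfolding V_def W_def using w Z by (intro weighted_sum_power_le) auto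
    finally show "\<omega> \<in> {\<omega> \<in> space M. t ^ Suc m \<le> V \<omega>}" using \<omega> by simp
  qed
  then have "prob A \<le> prob {\<omega> \<in> space M. t ^ Suc m \<le> V \<omega>}"
    by (intro finite_measure_mono) auto
  also have "\<dots> \<le> expectation V / t ^ Suc m"
    using t W w Z by (intro integral_Markov_inequality_measure[OF intV, where A = "{}"])
      (auto simp: V_def intro!: mult_nonneg_nonneg sum_nonneg)
  also have "expectation V = W ^ m * (\<Sum>i\<le>n. w i * expectation (\<lambda>\<omega>. Z i \<omega> ^ Suc m))"
    unfolding V_def using int by simp
  also have "\<dots> \<le> W ^ m * (\<Sum>i\<le>n. w i * C)"
    using W w mom by (intro mult_left_mono sum_mono) auto
  also have "\<dots> = W ^ Suc m * C" by (simp add: W_def mult_ac flip: sum_distrib_right sum_distrib_left)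
  also have "\<dots> \<le> suminf w ^ Suc m * C"
    using W C by (intro mult_right_mono power_mono)
  finally show ?thesis using t by (simp add: divide_right_mono)
qed

theorem theorem4:
  fixes M :: "'a measure"
    and F :: "'b::{banach, second_countable_topology} \<Rightarrow> 'b"
    and \<xi> x :: "nat \<Rightarrow> 'a \<Rightarrow> 'b"
    and xstar x\<^sub>1 :: 'b
    and a c \<sigma> L \<rho> N :: real
  assumes "prob_space M"
    and "c < 1" and "c-lipschitz_on UNIV F"
    and "F xstar = xstar"
    and "prob_space.indep_vars M (\<lambda>_. borel) \<xi> {1..}"
    and "\<And>n. n \<ge> 1 \<Longrightarrow> integrable M (\<xi> n)"
    and "\<And>n. n \<ge> 1 \<Longrightarrow> (\<integral>\<omega>. \<xi> n \<omega> \<partial>M) = 0"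
    and "bdd_above ((\<lambda>n. \<integral>\<omega>. norm (\<xi> n \<omega>) \<partial>M) ` {1..})"
    and "L > 0"
    and "\<And>i m. i \<ge> 1 \<Longrightarrow> m \<ge> 2 \<Longrightarrow> integrable M (\<lambda>\<omega>. norm (\<xi> i \<omega>) ^ m)"
    and "\<And>i m. i \<ge> 1 \<Longrightarrow> m \<ge> 2 \<Longrightarrow>
           (\<integral>\<omega>. norm (\<xi> i \<omega>) ^ m \<partial>M) \<le> fact m / 2 * \<sigma>\<^sup>2 * L ^ (m - 2)"
    and "a > 0" and "a * (1 - c) < 1"
    and "0 < \<rho>" and "\<rho> < 2 * a * (1 - c)"
    and "norm (x\<^sub>1 - xstar) \<le> N"
    and "\<And>\<omega>. \<omega> \<in> space M \<Longrightarrow> x 1 \<omega> = x\<^sub>1"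
    and "\<And>n \<omega>. n \<ge> 1 \<Longrightarrow> \<omega> \<in> space M \<Longrightarrow>
           x (n + 1) \<omega> = (1 - a / real n) *\<^sub>R x n \<omega>
             + (a / real n) *\<^sub>R (F (x n \<omega>) + (1 / real n) *\<^sub>R \<xi> n \<omega>)"
  shows "almost_completely_bigo M (\<lambda>n \<omega>. x (n + 1) \<omega> - xstar)
           (\<lambda>n. sqrt (ln (real n) / real n powr (a * (1 - c) - \<rho>)))"
proof -
  interpret prob_space M by fact
  note lip = assms(3) and fp = assms(4)
  note int\<xi> = assms(6) and momint = assms(10) and mom = assms(11) and step = assms(18)
  note x1 = assms(17)
  define \<alpha> where "\<alpha> = a * (1 - c)"
  have \<alpha>: "0 < \<alpha>" "\<alpha> < 1" using assms by (auto simp: \<alpha>_def)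
  \<comment> \<open>Multiplying the rate by \<open>n powr \<alpha>\<close> leaves the exponent
    \<open>\<alpha> - (\<alpha> - \<rho>) / 2 = \<delta>\<close>, up to the factor
    \<open>sqrt (ln n)\<close>.\<close>
  define \<delta> where "\<delta> = (\<alpha> + \<rho>) / 2"
  have \<delta>: "0 < \<delta>" using \<alpha> \<open>0 < \<rho>\<close> by (simp add: \<delta>_def)
  have contF: "continuous_on UNIV F" using lip by (rule lipschitz_on_continuous_on)
  have [measurable]: "F \<in> borel_measurable borel" using contF by (rule borel_measurable_continuous_onI)
  have meas\<xi>: "\<xi> n \<in> borel_measurable M" if "n \<ge> 1" for n
    using int\<xi>[OF that] by auto
  \<comment> \<open>The index is shifted because nothing is assumed about \<open>x 0\<close>. The
    defining equations hold only on \<open>space M\<close>, so measurability is transferred by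
    congruence.\<close>
  have measx: "x (Suc n) \<in> borel_measurable M" for n
  proof (induction n)
    case 0
    have "x (Suc 0) \<in> borel_measurable M \<longleftrightarrow> (\<lambda>_. x\<^sub>1) \<in> borel_measurable M"
      using x1 by (intro measurable_cong) auto
    then show ?case by simp
  next
    case (Suc n)
    note [measurable] = Suc meas\<xi>[of "Suc n", simplified]
    have "x (Suc (Suc n)) \<in> borel_measurable M \<longleftrightarrow>
      (\<lambda>\<omega>. (1 - a / real (Suc n)) *\<^sub>R x (Suc n) \<omega>
         + (a / real (Suc n)) *\<^sub>R (F (x (Suc n) \<omega>) + (1 / real (Suc n)) *\<^sub>R \<xi> (Suc n) \<omega>)) \<in> borel_measurable M"
      using step[of "Suc n"] by (intro measurable_cong) auto
    then show ?case by simp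
  qed
  \<comment> \<open>The first condition makes the tail of order \<open>k powr (- 2)\<close>; the
    second is needed because the moment assumptions start at order 2 and the moment used is
    \<open>Suc m\<close>.\<close>
  obtain m :: nat where m: "2 \<le> \<delta> * real (Suc m)" "1 \<le> m"
  proof -
    obtain k :: nat where "2 / \<delta> \<le> real k" using real_arch_simple by blast
    then have "2 \<le> \<delta> * real k" using \<delta> by (simp add: field_simps)
    also have "\<dots> \<le> \<delta> * real (Suc (max 1 k))" using \<delta> by (intro mult_left_mono) auto
    finally show ?thesis by (intro that[of "max 1 k"]) auto
  qed
  define K where "K = (2 * (1 + 2 * a)) ^ nat \<lceil>a\<rceil>"
  have K: "0 < K" using \<open>a > 0\<close> by (simp add: K_def)
  define w where "w i = (if i = 0 then norm (x\<^sub>1 - xstar) else 2 * a * real i powr (\<alpha> - 2))" for i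
  \<comment> \<open>the deterministic initial error enters the weighted sum as the term of index 0\<close>
  define Z where "Z i \<omega> = (if i = 0 then 1 else norm (\<xi> i \<omega>))" for i \<omega>
  \<comment> \<open>The bound on the moments of the noise does not depend on \<open>i\<close>; the
    \<open>max 1\<close> covers index 0, where \<open>Z\<close> is constantly 1.\<close>
  define C where "C = max 1 (fact (Suc m) / 2 * \<sigma>\<^sup>2 * L ^ (Suc m - 2))"
  \<comment> \<open>As \<open>\<alpha> < 1\<close>, the exponent \<open>\<alpha> - 2\<close> lies
    below -1; the different value at index 0 does not affect summability.\<close>
  have sw: "summable w"
  proof -
    have "summable (\<lambda>i. 2 * a * real i powr (\<alpha> - 2))"
      using \<alpha> by (intro summable_mult) (simp add: summable_real_powr_iff)
    then show ?thesis
      by (rule summable_cong[THEN iffD1, rotated]) (auto simp: w_def eventually_at_top_linorder intro!: exI[of _ 1])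
  qed
  have w0: "0 \<le> w i" for i using \<open>a > 0\<close> by (simp add: w_def)
  have intZ: "integrable M (\<lambda>\<omega>. Z i \<omega> ^ Suc m)" for i
    using momint[of i "Suc m"] m by (cases "i = 0") (auto simp: Z_def)
  have momZ: "expectation (\<lambda>\<omega>. Z i \<omega> ^ Suc m) \<le> C" for i
    using mom[of i "Suc m"] m by (cases "i = 0") (auto simp: Z_def C_def prob_space)
  have error: "real (Suc n) powr \<alpha> * norm (x (Suc n) \<omega> - xstar) \<le> K * (\<Sum>i\<le>n. w i * Z i \<omega>)"
    if "\<omega> \<in> space M" for n \<omega>
  proof -
    have "real (Suc n) powr \<alpha> * norm (x (Suc n) \<omega> - xstar)
      \<le> K * (norm (x 1 \<omega> - xstar) + (\<Sum>i=1..n. 2 * a * real i powr (\<alpha> - 2) * norm (\<xi> i \<omega>)))"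
      unfolding K_def \<alpha>_def using assms(2,12,13) step[OF _ that]
      by (intro mann_error_bound[OF lip fp]) auto
    also have "norm (x 1 \<omega> - xstar) + (\<Sum>i=1..n. 2 * a * real i powr (\<alpha> - 2) * norm (\<xi> i \<omega>))
      = w 0 * Z 0 \<omega> + (\<Sum>i=1..n. w i * Z i \<omega>)"
      using x1[OF that] by (auto simp: w_def Z_def intro!: sum.cong)
    also have "\<dots> = (\<Sum>i\<le>n. w i * Z i \<omega>)"
      by (simp add: atMost_atLeast0 sum.atLeast_Suc_atMost)
    finally show ?thesis .
  qed
  define r where "r n = sqrt (ln (real n) / real n powr (\<alpha> - \<rho>))" for n :: nat
  have r: "real k powr \<delta> \<le> real (Suc k) powr \<alpha> * r k" if "k \<ge> 3" for k
  proof -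
    have "exp 1 \<le> real k" using e_less_272 that by linarith
    then have ln: "1 \<le> ln (real k)" using that by (subst ln_ge_iff) auto
    have "real k powr \<delta> = real k powr \<alpha> * sqrt (1 / real k powr (\<alpha> - \<rho>))"
      using that by (simp add: real_sqrt_divide powr_half_sqrt[symmetric] powr_powr powr_diff[symmetric] \<delta>_def field_simps powr_add[symmetric])
    also have "\<dots> \<le> real (Suc k) powr \<alpha> * r k"
      unfolding r_def using ln \<alpha> that
      by (intro mult_mono powr_mono2 real_sqrt_le_mono divide_right_mono) auto
    finally show ?thesis .
  qed
  \<comment> \<open>The constant 1 serves as the witness for \<open>\<epsilon>\<^sub>0\<close>,
    since the factor \<open>k powr \<delta>\<close> outgrows the constant \<open>K\<close>.\<close>
  define P where "P k = prob {\<omega> \<in> space M. norm (x (Suc k) \<omega> - xstar) > 1 * r k}" for k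
  define D where "D = suminf w ^ Suc m * C * K ^ Suc m"
  have D0: "0 \<le> D" using sw w0 K by (auto simp: D_def C_def suminf_nonneg)
  have bound: "P k \<le> D * real k powr (- 2)" if k: "k \<ge> 3" for k
  proof -
    have "{\<omega> \<in> space M. norm (x (Suc k) \<omega> - xstar) > 1 * r k}
      \<subseteq> {\<omega> \<in> space M. real k powr \<delta> / K \<le> (\<Sum>i\<le>k. w i * Z i \<omega>)}"
    proof safe
      fix \<omega> assume \<omega>: "\<omega> \<in> space M" "norm (x (Suc k) \<omega> - xstar) > 1 * r k"
      have "real k powr \<delta> \<le> real (Suc k) powr \<alpha> * r k" by (rule r[OF k])
      also have "\<dots> \<le> real (Suc k) powr \<alpha> * norm (x (Suc k) \<omega> - xstar)"
        using \<omega> by (intro mult_left_mono) auto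
      also have "\<dots> \<le> K * (\<Sum>i\<le>k. w i * Z i \<omega>)" by (rule error[OF \<omega>(1)])
      finally show "real k powr \<delta> / K \<le> (\<Sum>i\<le>k. w i * Z i \<omega>)"
        using K by (simp add: field_simps)
    qed
    then have "P k \<le> suminf w ^ Suc m * C / (real k powr \<delta> / K) ^ Suc m"
      unfolding P_def using k K
      by (intro weighted_sum_tail[OF w0 sw _ intZ momZ]) (auto simp: Z_def)
    also have "\<dots> = D * real k powr (- (\<delta> * real (Suc m)))"
    proof -
      have "(real k powr \<delta>) ^ Suc m = real k powr (\<delta> * real (Suc m))"
        using k by (simp only: powr_power mult.commute)
      then show ?thesis
        by (simp only: power_divide powr_minus D_def) (simp add: divide_inverse mult_ac del: power_Suc of_nat_Suc)
    qed
    also have "\<dots> \<le> D * real k powr (- 2)"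
      using k m D0 by (intro mult_left_mono powr_mono) auto
    finally show ?thesis .
  qed
  have "summable (\<lambda>k. D * real k powr (- 2))"
    by (intro summable_mult) (simp add: summable_real_powr_iff)
  then have "summable P"
    by (rule summable_comparison_test[rotated]) (use bound in \<open>auto simp: P_def intro!: exI[of _ 3]\<close>)
  \<comment> \<open>The shift makes the series start at 1, as in
    \<open>almost_completely_bigo\<close>.\<close>
  then have "summable (\<lambda>n. P (Suc n))" by (simp only: summable_Suc_iff)
  then have "\<exists>\<epsilon>>0. summable (\<lambda>n. prob {\<omega> \<in> space M. norm (x (Suc n + 1) \<omega> - xstar) > \<epsilon> * r (Suc n)})"
    by (intro exI[of _ 1]) (simp add: P_def)
  moreover have "(\<lambda>\<omega>. x (n + 1) \<omega> - xstar) \<in> borel_measurable M" for n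
    using measx[of n] by simp
  ultimately show ?thesis
    unfolding almost_completely_bigo_def r_def \<alpha>_def by blast
qed

end
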